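(* For $n\geq 1$, let $$Q_n^{(1)}(z) = \sum_{k=0}^{n-1}c_n(k)z^k,\qquad R_n^{(1)}(z) = \sum_{k=0}^{n}d_n(k)z^k.$$ Then $c_n(k)$ is the number of restricted colored base-$3$ partitions of $\frac{1}{2}(3^n-3)$ having exactly $k$ single unmarked powers of $3$. Similarly, $d_n(k)$ is the number of restricted colored base-$3$ partitions of $\frac{1}{2}(3^n-1)$ having exactly $k$ single unmarked powers of $3$.
   Context: Let $Z=(w,x,y,z)$ be a quadruple of variables. The polynomials $S(n;Z)$, $n\ge 0$, are defined by the generating function $$\sum_{n=0}^{\infty}S(n;Z)q^n = \prod_{j=0}^{\infty}\left(1+wq^{3^j}\right)\left(1+xq^{3^j}\right)\left(1+yq^{3^j}+zq^{2\cdot 3^j}\right).$$ Define $Q_n(Z):=S(\tfrac{3^n-3}{2};Z)$ and $R_n(Z):=S(\tfrac{3^n-1}{2};Z)$ for $n\geq 1$, and $Q_n^{(1)}(z):=Q_n(1,1,z,1)$, $R_n^{(1)}(z):=R_n(1,1,z,1)$. A restricted colored base-$3$ partition of an integer $m\geq 0$ is a way of writing $m$ as a sum of powers of $3$ (with $3^0=1$ allowed; the order of the summands is irrelevant), where each part is either overlined, marked by a tilde, or unmarked (no part carries both marks), such that for every power $3^j$: at most one copy of $3^j$ is overlined, at most one copy of $3^j$ is marked by a tilde, and at most two copies of $3^j$ are unmarked. The integer $0$ has exactly one such partition, the empty one. A single unmarked power of $3$ in a partition is a power $3^j$ of which exactly one unmarked copy occurs. *)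

theory Defs
  imports
    "HOL-Analysis.Analysis"
    "HOL-Computational_Algebra.Computational_Algebra"
    "HOL-Library.Multiset"
begin

(* Polynomials over the integers in (w, x, y, z) as iterated univariate polynomials:
   the outermost indeterminate is w, the innermost one is z. *)
type_synonym poly4 = "int poly poly poly poly"

definition var_w :: poly4 where "var_w = [:0, 1:]"
definition var_x :: poly4 where "var_x = [:[:0, 1:]:]"
definition var_y :: poly4 where "var_y = [:[:[:0, 1:]:]:]"
definition var_z :: poly4 where "var_z = [:[:[:[:0, 1:]:]:]:]"

(* Substitution of elements w, x, y, z of an arbitrary commutative ring for the
   four indeterminates. *)
definition subst4 :: "poly4 \<Rightarrow> 'a::comm_ring_1 \<Rightarrow> 'a \<Rightarrow> 'a \<Rightarrow> 'a \<Rightarrow> 'a" where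
  "subst4 P w x y z =
     poly (map_poly (\<lambda>A. poly (map_poly (\<lambda>B. poly (map_poly (\<lambda>C.
       poly (map_poly of_int C) z) B) y) A) x) P) w"

(* The infinite product is a limit in the metric on formal power series, i.e. the
   q-adic one. *)
definition S_genfun :: "poly4 fps" where
  "S_genfun = (\<Prod>j. (1 + fps_const var_w * fps_X ^ (3 ^ j)) *
                    (1 + fps_const var_x * fps_X ^ (3 ^ j)) *
                    (1 + fps_const var_y * fps_X ^ (3 ^ j) + fps_const var_z * fps_X ^ (2 * 3 ^ j)))"

definition S_poly :: "nat \<Rightarrow> poly4" where
  "S_poly n = fps_nth S_genfun n"

(* For n \<ge> 1, the natural number divisions here are exact and the subtractions do not truncate. *)
definition Q_poly :: "nat \<Rightarrow> poly4" where
  "Q_poly n = S_poly ((3 ^ n - 3) div 2)"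

definition R_poly :: "nat \<Rightarrow> poly4" where
  "R_poly n = S_poly ((3 ^ n - 1) div 2)"

definition Q1_poly :: "nat \<Rightarrow> int poly" where
  "Q1_poly n = subst4 (Q_poly n) 1 1 [:0, 1:] 1"

definition R1_poly :: "nat \<Rightarrow> int poly" where
  "R1_poly n = subst4 (R_poly n) 1 1 [:0, 1:] 1"

datatype mark = Overlined | Tilde | Unmarked

(* A partition is the multiset of its parts; a part consists of its numerical value
   and its mark. *)
definition restricted_colored_partition :: "nat \<Rightarrow> (nat \<times> mark) multiset \<Rightarrow> bool" where
  "restricted_colored_partition m P \<longleftrightarrow>
     (\<forall>p \<in># P. \<exists>j. fst p = 3 ^ j) \<and>
     sum_mset (image_mset fst P) = m \<and>
     (\<forall>j. count P (3 ^ j, Overlined) \<le> 1 \<and>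
          count P (3 ^ j, Tilde) \<le> 1 \<and>
          count P (3 ^ j, Unmarked) \<le> 2)"

definition single_unmarked_powers :: "(nat \<times> mark) multiset \<Rightarrow> nat set" where
  "single_unmarked_powers P = {t. (\<exists>j. t = 3 ^ j) \<and> count P (t, Unmarked) = 1}"

(* Both cardinalities involved below are of finite sets. *)
lemma finite_single_unmarked_powers: "finite (single_unmarked_powers P)"
proof (rule finite_subset)
  show "single_unmarked_powers P \<subseteq> fst ` set_mset P"
  proof
    fix t assume "t \<in> single_unmarked_powers P"
    then have "(t, Unmarked) \<in># P"
      unfolding single_unmarked_powers_def by (metis (mono_tags) mem_Collect_eq count_eq_zero_iff zero_neq_one)
    then show "t \<in> fst ` set_mset P" by force
  qed
qed simp

lemma finite_restricted_colored_partitions: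
  "finite {P. restricted_colored_partition m P}"
proof (rule finite_subset)
  have UNIV_mark: "(UNIV :: mark set) = {Overlined, Tilde, Unmarked}"
    using mark.exhaust by auto
  show "finite (\<Union>n\<le>m. multisets_of_size ({..m} \<times> (UNIV :: mark set)) n)"
    by (intro finite_UN_I finite_multisets_of_size finite_cartesian_product)
       (simp_all add: UNIV_mark)
  show "{P. restricted_colored_partition m P} \<subseteq>
        (\<Union>n\<le>m. multisets_of_size ({..m} \<times> (UNIV :: mark set)) n)"
  proof
    fix P assume "P \<in> {P. restricted_colored_partition m P}"
    then have pow: "\<forall>p \<in># P. \<exists>j. fst p = 3 ^ j" and sum: "sum_mset (image_mset fst P) = m"
      by (auto simp: restricted_colored_partition_def)
    have "size P \<le> sum_mset (image_mset fst P)"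
      using pow
    proof (induction P)
      case (add p P)
      then have "1 \<le> fst p" by fastforce
      with add show ?case by auto
    qed simp
    moreover have "fst p \<le> m" if "p \<in># P" for p
    proof -
      from that obtain P' where "P = add_mset p P'" by (metis multi_member_split)
      then show ?thesis using sum by auto
    qed
    ultimately show "P \<in> (\<Union>n\<le>m. multisets_of_size ({..m} \<times> (UNIV :: mark set)) n)"
      using sum by (auto simp: multisets_of_size_def mem_Times_iff)
  qed
qed

definition num_partitions_single_unmarked :: "nat \<Rightarrow> nat \<Rightarrow> nat" where
  "num_partitions_single_unmarked m k =
     card {P. restricted_colored_partition m P \<and> card (single_unmarked_powers P) = k}"

end

theory Submission
  imports Defs
begin

text \<open>
  Multiplying out the product means choosing, for each power \<open>3 ^ j\<close>, one term of the
  \<open>j\<close>-th factor: \<open>w\<close> or not (an overlined copy or none), \<open>x\<close> or not (a copy with a tilde or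
  none), and \<open>1\<close>, \<open>y\<close> or \<open>z\<close> (zero, one or two unmarked copies). Such a system of choices is
  a restricted colored partition, and the exponent of \<open>q\<close> is the number being partitioned. Hence
  \<open>S(m; Z)\<close> is a sum over the partitions of \<open>m\<close>, in which every single unmarked power
  contributes a factor \<open>y\<close> (\<open>S_poly_eq_sum_partitions\<close>). Setting \<open>w = x = z = 1\<close> leaves
  \<open>y\<close> raised to the number of single unmarked powers, so that the coefficients of the specialised
  polynomial count partitions by that number (\<open>coeff_specialised_S_poly\<close>).

  Two points need care. The generating function is a limit, but the factors with \<open>3 ^ j > m\<close>
  do not affect the coefficient at \<open>q ^ m\<close>, which is therefore a coefficient of a finite product
  (\<open>prodinf_nth\<close>). The stated ranges of summation are bounds on degrees: only the \<open>n\<close> powers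
  \<open>1, 3, \<dots>, 3 ^ (n - 1)\<close> can be parts, which bounds the degree by \<open>n\<close>; if all of them were
  single, the parts would add up to at least \<open>(3 ^ n - 1) / 2 > (3 ^ n - 3) / 2\<close>, which gives the
  better bound \<open>n - 1\<close> in the first case.
\<close>

section \<open>Infinite products of formal power series\<close>

text \<open>
  The \<open>j\<close>-th factor is congruent to 1 modulo \<open>X ^ e j\<close>, so multiplication by it preserves
  every coefficient below \<open>e j\<close>.
\<close>

lemma prod_nth_stable:
  fixes f :: "nat \<Rightarrow> 'a::comm_ring_1 fps"
  assumes "strict_mono e"
    and "\<And>j. fps_nth (f j) 0 = 1"
    and "\<And>j i. 0 < i \<Longrightarrow> i < e j \<Longrightarrow> fps_nth (f j) i = 0"
    and "m < e N" and "N \<le> M"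
  shows "fps_nth (\<Prod>j<M. f j) m = fps_nth (\<Prod>j<N. f j) m"
  using \<open>N \<le> M\<close>
proof (induction M rule: dec_induct)
  case base
  then show ?case by simp
next
  case (step M)
  have "e N \<le> e M" using step(1) assms(1) by (simp add: strict_mono_less_eq)
  then have "fps_nth (f M) (m - i) = (if i = m then 1 else 0)" if "i \<le> m" for i
    using assms(2,3) \<open>m < e N\<close> that by auto
  then have "fps_nth ((\<Prod>j<M. f j) * f M) m = (\<Sum>i=0..m. if i = m then fps_nth (\<Prod>j<M. f j) i else 0)"
    unfolding fps_mult_nth by (intro sum.cong) auto
  also have "\<dots> = fps_nth (\<Prod>j<M. f j) m" by simp
  finally show ?case using step.IH by simp
qed

text \<open>
  Since its coefficients stabilise, the sequence of partial products converges in the metric of formal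
  power series, and the coefficients of the limit are the stable ones.
\<close>

lemma prodinf_nth:
  fixes f :: "nat \<Rightarrow> 'a::idom fps"
  assumes "strict_mono e"
    and "\<And>j. fps_nth (f j) 0 = 1"
    and "\<And>j i. 0 < i \<Longrightarrow> i < e j \<Longrightarrow> fps_nth (f j) i = 0"
    and "m < e N"
  shows "fps_nth (prodinf f) m = fps_nth (\<Prod>j<N. f j) m"
proof -
  \<comment> \<open>Since \<open>i < e (Suc i)\<close>, the first \<open>Suc i\<close> factors determine the \<open>i\<close>-th coefficient.\<close>
  define G where "G = Abs_fps (\<lambda>i. fps_nth (\<Prod>j<Suc i. f j) i)"
  have less: "i < e (Suc i)" for i
    using strict_mono_imp_increasing[OF assms(1), of "Suc i"] by simp
  have G: "fps_nth (\<Prod>j<M. f j) i = fps_nth G i" if "i < e M" for i M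
    using prod_nth_stable[OF assms(1-3), where N = "Suc i" and M = "max M (Suc i)" and m = i, simplified]
      prod_nth_stable[OF assms(1-3), where N = M and M = "max M (Suc i)" and m = i, simplified] less[of i] that
    by (simp add: G_def)
  have "(\<lambda>n. \<Prod>j\<le>n. f j) \<longlonglongrightarrow> G"
  proof (rule tendsto_fpsI)
    fix i
    show "\<forall>\<^sub>F n in sequentially. fps_nth (\<Prod>j\<le>n. f j) i = fps_nth G i"
      using eventually_ge_at_top[of i]
    proof eventually_elim
      case (elim n)
      then have "i < e (Suc n)"
        using strict_mono_imp_increasing[OF assms(1), of "Suc n"] by simp
      then show ?case using G[of i "Suc n"] by (simp only: lessThan_Suc_atMost)
    qed
  qed
  \<comment> \<open>An infinite product with nonzero factors is only defined if its limit is nonzero.\<close>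
  moreover have "G \<noteq> 0"
    using assms(2)[of 0] by (auto simp: G_def fps_eq_iff intro!: exI[of _ 0])
  ultimately have "f has_prod G"
    by (simp add: has_prod_def raw_has_prod_def)
  then have "prodinf f = G"
    by (simp add: has_prod_unique[symmetric])
  then show ?thesis using G assms(4) by simp
qed

section \<open>Expansion of the generating function\<close>

text \<open>
  The numbers of overlined, tilde and unmarked copies of one power of 3, in this order.
\<close>

type_synonym digit = "nat \<times> nat \<times> nat"

definition digits :: "digit set" where
  "digits = {0..1} \<times> {0..1} \<times> {0..2}"

fun digit_value :: "digit \<Rightarrow> nat" where
  "digit_value (a, b, c) = a + b + c"

text \<open>
  The coefficient contributed by a choice of terms from one factor. The last case of the conditional
  stands for exactly two unmarked copies, as \<open>digits\<close> allows no more; the value at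
  triples outside \<open>digits\<close> carries no meaning.
\<close>

fun digit_weight :: "'a::comm_semiring_1 \<Rightarrow> 'a \<Rightarrow> 'a \<Rightarrow> 'a \<Rightarrow> digit \<Rightarrow> 'a" where
  "digit_weight w x y z (a, b, c) = w ^ a * x ^ b * (if c = 0 then 1 else if c = 1 then y else z)"

lemma finite_digits: "finite digits"
  by (simp add: digits_def)

text \<open>
  The three brackets are the sums over the three components of a digit, because \<open>digit_weight\<close>
  is multiplicative in the components and \<open>digit_value\<close> is additive.
\<close>

lemma factor_expansion:
  fixes w x y z :: "'a::comm_ring_1"
  shows "(1 + fps_const w * fps_X ^ e) * (1 + fps_const x * fps_X ^ e) *
           (1 + fps_const y * fps_X ^ e + fps_const z * fps_X ^ (2 * e)) =
         (\<Sum>d\<in>digits. fps_const (digit_weight w x y z d) * fps_X ^ (e * digit_value d))"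
proof -
  have term_eq: "fps_const (digit_weight w x y z (a, b, c)) * fps_X ^ (e * digit_value (a, b, c)) =
      (fps_const w * fps_X ^ e) ^ a * ((fps_const x * fps_X ^ e) ^ b *
        (fps_const (if c = 0 then 1 else if c = 1 then y else z) * fps_X ^ (c * e)))" for a b c
  proof -
    have "fps_const (digit_weight w x y z (a, b, c)) =
        fps_const w ^ a * fps_const x ^ b * fps_const (if c = 0 then 1 else if c = 1 then y else z)"
      by (simp only: digit_weight.simps fps_const_mult fps_const_power)
    moreover have "fps_X ^ (e * digit_value (a, b, c)) =
        (fps_X ^ e) ^ a * (fps_X ^ e) ^ b * (fps_X ^ (c * e) :: 'a fps)"
      by (simp add: distrib_left power_add power_mult mult.commute[of c])
    ultimately show ?thesis by (simp only: power_mult_distrib ac_simps)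
  qed
  have sets: "{0..1::nat} = {0, 1}" "{0..2::nat} = {0, 1, 2}" by auto
  have "(\<Sum>d\<in>digits. fps_const (digit_weight w x y z d) * fps_X ^ (e * digit_value d)) =
      (\<Sum>a\<in>{0..1}. \<Sum>b\<in>{0..1}. \<Sum>c\<in>{0..2}.
         fps_const (digit_weight w x y z (a, b, c)) * fps_X ^ (e * digit_value (a, b, c)))"
    unfolding digits_def sum.cartesian_product by (intro sum.cong) auto
  also have "\<dots> = (\<Sum>a\<in>{0..1}. (fps_const w * fps_X ^ e) ^ a) *
      ((\<Sum>b\<in>{0..1}. (fps_const x * fps_X ^ e) ^ b) *
       (\<Sum>c\<in>{0..2}. fps_const (if c = 0 then 1 else if c = 1 then y else z) * fps_X ^ (c * e)))"
    unfolding term_eq by (simp only: sum_distrib_left[symmetric] sum_distrib_right[symmetric])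
  also have "\<dots> = (1 + fps_const w * fps_X ^ e) * ((1 + fps_const x * fps_X ^ e) *
      (1 + fps_const y * fps_X ^ e + fps_const z * fps_X ^ (2 * e)))"
    unfolding sets by (simp add: add.assoc)
  finally show ?thesis by (simp only: mult.assoc)
qed

text \<open>
  By distributivity, the terms of the product correspond to the functions choosing one digit for each
  of the powers \<open>3 ^ j\<close>.
\<close>

lemma finite_product_nth:
  fixes w x y z :: "'a::comm_ring_1"
  shows "fps_nth (\<Prod>j<N. (1 + fps_const w * fps_X ^ (3 ^ j)) * (1 + fps_const x * fps_X ^ (3 ^ j)) *
           (1 + fps_const y * fps_X ^ (3 ^ j) + fps_const z * fps_X ^ (2 * 3 ^ j))) m =
         (\<Sum>g | g \<in> {..<N} \<rightarrow>\<^sub>E digits \<and> (\<Sum>j<N. 3 ^ j * digit_value (g j)) = m.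
            \<Prod>j<N. digit_weight w x y z (g j))"
proof -
  have prod: "(\<Prod>j<N. fps_const (digit_weight w x y z (g j)) * fps_X ^ (3 ^ j * digit_value (g j))) =
      fps_const (\<Prod>j<N. digit_weight w x y z (g j)) * fps_X ^ (\<Sum>j<N. 3 ^ j * digit_value (g j))" for g
    by (induction N) (simp_all add: power_add algebra_simps flip: fps_const_mult)
  have fin: "finite ({..<N} \<rightarrow>\<^sub>E digits)"
    by (intro finite_PiE) (simp_all add: finite_digits)
  show ?thesis
    unfolding factor_expansion
    by (subst prod_sum_PiE)
      (auto simp: finite_digits prod fps_sum_nth sum.inter_filter[OF fin, symmetric]
        if_distrib[of "times _"] cong: if_cong intro!: sum.cong)
qed

section \<open>Partitions and their multiplicities\<close>

definition multiplicities :: "(nat \<times> mark) multiset \<Rightarrow> nat \<Rightarrow> digit" where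
  "multiplicities P j =
     (count P (3 ^ j, Overlined), count P (3 ^ j, Tilde), count P (3 ^ j, Unmarked))"

text \<open>
  The part of a partition that lives on \<open>3 ^ j\<close>; a partition is the sum of its blocks, so
  that it can be recovered from its \<open>multiplicities\<close>.
\<close>

fun block :: "nat \<Rightarrow> digit \<Rightarrow> (nat \<times> mark) multiset" where
  "block j (a, b, c) = replicate_mset a (3 ^ j, Overlined) +
     replicate_mset b (3 ^ j, Tilde) + replicate_mset c (3 ^ j, Unmarked)"

lemma multiplicities_sum_block:
  "multiplicities (\<Sum>j<N. block j (g j)) i = (if i < N then g i else (0, 0, 0))"
proof -
  have "count (block j d) (3 ^ i, Overlined) = (if i = j then fst d else 0)"
    "count (block j d) (3 ^ i, Tilde) = (if i = j then fst (snd d) else 0)"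
    "count (block j d) (3 ^ i, Unmarked) = (if i = j then snd (snd d) else 0)" for j d
    by (cases d; auto)+
  then show ?thesis by (simp add: multiplicities_def count_sum)
qed

lemma fst_in_sum_blocks: "p \<in># (\<Sum>j<N. block j (g j)) \<Longrightarrow> \<exists>j<N. fst p = 3 ^ j"
proof (induction N)
  case (Suc N)
  have "fst p = 3 ^ N" if "p \<in># block N d" for d
    using that by (cases d) (auto split: if_splits)
  moreover from Suc.prems have "p \<in># (\<Sum>j<N. block j (g j)) \<or> p \<in># block N (g N)"
    by simp
  ultimately consider "p \<in># (\<Sum>j<N. block j (g j))" | "fst p = 3 ^ N"
    by blast
  then show ?case by cases (use Suc.IH less_Suc_eq in blast)+
qed simp

lemma sum_fst_blocks:
  "sum_mset (image_mset fst (\<Sum>j<N. block j (g j))) = (\<Sum>j<N. 3 ^ j * digit_value (g j))"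
proof (induction N)
  case (Suc N)
  have "sum_mset (image_mset fst (block N d)) = 3 ^ N * digit_value d" for d
    by (cases d) (simp add: algebra_simps)
  with Suc show ?case by simp
qed simp

lemma sum_blocks_multiplicities:
  assumes "\<And>p. p \<in># P \<Longrightarrow> \<exists>j<N. fst p = 3 ^ j"
  shows "(\<Sum>j<N. block j (multiplicities P j)) = P" (is "?B = P")
proof (rule multiset_eqI)
  fix p :: "nat \<times> mark"
  show "count ?B p = count P p"
  proof (cases "\<exists>j<N. fst p = 3 ^ j")
    case True
    then obtain j where j: "j < N" "fst p = 3 ^ j" by blast
    then have "multiplicities ?B j = multiplicities P j"
      by (simp add: multiplicities_sum_block)
    moreover have "p = (3 ^ j, snd p)" using j by (simp add: prod_eq_iff)
    ultimately show ?thesis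
      by (cases "snd p") (simp_all add: multiplicities_def)
  next
    case False
    then have "p \<notin># P" using assms by blast
    moreover have "p \<notin># ?B"
      using False fst_in_sum_blocks by blast
    ultimately show ?thesis by (simp add: not_in_iff)
  qed
qed

lemma part_exponent_less:
  assumes "restricted_colored_partition m P" and "m < 3 ^ N" and "p \<in># P"
  shows "\<exists>j<N. fst p = 3 ^ j"
proof -
  from assms obtain j where j: "fst p = 3 ^ j"
    by (auto simp: restricted_colored_partition_def)
  have le: "fst p \<le> m"
    using assms(1,3) multi_member_split[OF assms(3)]
    by (auto simp: restricted_colored_partition_def)
  have "(3::nat) ^ j < 3 ^ N"
    using le assms(2) unfolding j by (rule le_less_trans)
  then have "j < N" by simp
  then show ?thesis using j by blast
qed

lemma restricted_colored_partition_value: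
  assumes "restricted_colored_partition m P" and "m < 3 ^ N"
  shows "(\<Sum>j<N. 3 ^ j * digit_value (multiplicities P j)) = m"
  using sum_fst_blocks[where N = N and g = "multiplicities P"] sum_blocks_multiplicities[of P N]
    part_exponent_less[OF assms] assms(1)
  by (simp add: restricted_colored_partition_def)

lemma restricted_colored_partition_blocks:
  assumes "g \<in> {..<N} \<rightarrow>\<^sub>E digits" and "(\<Sum>j<N. 3 ^ j * digit_value (g j)) = m"
  shows "restricted_colored_partition m (\<Sum>j<N. block j (g j))" (is "restricted_colored_partition m ?B")
proof -
  have "multiplicities ?B j \<in> digits" for j
    using assms(1) by (auto simp: multiplicities_sum_block digits_def PiE_def Pi_def)
  then have "count ?B (3 ^ j, Overlined) \<le> 1 \<and> count ?B (3 ^ j, Tilde) \<le> 1 \<and>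
      count ?B (3 ^ j, Unmarked) \<le> 2" for j
    by (force simp: multiplicities_def digits_def)
  moreover have "\<exists>j. fst p = 3 ^ j" if "p \<in># ?B" for p
    using fst_in_sum_blocks[OF that] by blast
  ultimately show ?thesis
    using sum_fst_blocks[where N = N and g = g] assms(2) by (simp add: restricted_colored_partition_def)
qed

text \<open>
  Multiplicities and sums of blocks are mutually inverse bijections between the partitions of \<open>m\<close>
  and the digit functions of total value \<open>m\<close>. The bound on \<open>m\<close> ensures that all parts of a
  partition are among the first \<open>N\<close> powers of 3.
\<close>

lemma sum_over_partitions:
  fixes F :: "digit \<Rightarrow> 'a::comm_semiring_1"
  assumes "m < 3 ^ N"
  shows "(\<Sum>g | g \<in> {..<N} \<rightarrow>\<^sub>E digits \<and> (\<Sum>j<N. 3 ^ j * digit_value (g j)) = m. \<Prod>j<N. F (g j)) =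
         (\<Sum>P | restricted_colored_partition m P. \<Prod>j<N. F (multiplicities P j))"
proof (rule sum.reindex_bij_witness[where
      i = "\<lambda>P. restrict (multiplicities P) {..<N}" and j = "\<lambda>g. \<Sum>j<N. block j (g j)"], goal_cases)
  case (1 g)
  then show ?case
    by (auto simp: multiplicities_sum_block PiE_def extensional_def fun_eq_iff)
next
  case (2 g)
  then show ?case by (auto intro: restricted_colored_partition_blocks)
next
  case (3 P)
  then show ?case
    using part_exponent_less[OF _ assms] by (simp add: sum_blocks_multiplicities)
next
  case (4 P)
  then have "multiplicities P j \<in> digits" for j
    by (auto simp: restricted_colored_partition_def multiplicities_def digits_def)
  with 4 show ?case
    using restricted_colored_partition_value[OF _ assms] by auto
next
  case (5 g)
  then show ?case by (simp add: multiplicities_sum_block)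
qed

text \<open>
  The combinatorial meaning of \<open>S\<close> in all four variables. All large
  \<open>N\<close> give the same value, as a power of 3 that does not occur has weight 1.
\<close>

theorem S_poly_eq_sum_partitions:
  assumes "m < 3 ^ N"
  shows "S_poly m = (\<Sum>P | restricted_colored_partition m P.
           \<Prod>j<N. digit_weight var_w var_x var_y var_z (multiplicities P j))"
proof -
  have "S_poly m = fps_nth (\<Prod>j<N. (1 + fps_const var_w * fps_X ^ (3 ^ j)) *
      (1 + fps_const var_x * fps_X ^ (3 ^ j)) *
      (1 + fps_const var_y * fps_X ^ (3 ^ j) + fps_const var_z * fps_X ^ (2 * 3 ^ j))) m"
    unfolding S_poly_def S_genfun_def
  proof (rule prodinf_nth[where e = "\<lambda>j. 3 ^ j"])
    show "strict_mono (\<lambda>j. 3 ^ j :: nat)" by (auto simp: strict_mono_def)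
    fix j i :: nat
    show "0 < i \<Longrightarrow> i < 3 ^ j \<Longrightarrow>
      fps_nth ((1 + fps_const var_w * fps_X ^ (3 ^ j)) * (1 + fps_const var_x * fps_X ^ (3 ^ j)) *
        (1 + fps_const var_y * fps_X ^ (3 ^ j) + fps_const var_z * fps_X ^ (2 * 3 ^ j))) i = 0"
      unfolding factor_expansion
      by (auto simp: fps_sum_nth fps_X_power_nth intro!: sum.neutral)
  qed (use assms in auto)
  then show ?thesis by (simp add: finite_product_nth sum_over_partitions[OF assms])
qed

section \<open>Substitution as a ring homomorphism\<close>

text \<open>
  \<open>subst4\<close> maps the coefficients of a polynomial by a ring homomorphism and then evaluates, four
  times over. It is therefore enough that one such step yields a homomorphism again
  (\<open>eval_map_poly_hom\<close> below).
\<close>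

locale unital_ring_hom =
  fixes h :: "'a::comm_ring_1 \<Rightarrow> 'b::comm_ring_1"
  assumes hom_add: "h (a + b) = h a + h b"
    and hom_mult: "h (a * b) = h a * h b"
    and hom_one: "h 1 = 1"
begin

lemma hom_zero: "h 0 = 0"
  using hom_add[of 0 0] by simp

lemma hom_sum: "h (sum f A) = (\<Sum>a\<in>A. h (f a))"
  by (induction A rule: infinite_finite_induct) (simp_all add: hom_zero hom_add)

lemma hom_prod: "h (prod f A) = (\<Prod>a\<in>A. h (f a))"
  by (induction A rule: infinite_finite_induct) (simp_all add: hom_one hom_mult)

lemma hom_power: "h (a ^ n) = h a ^ n"
  by (induction n) (simp_all add: hom_one hom_mult)

lemma hom_digit_weight: "h (digit_weight w x y z d) = digit_weight (h w) (h x) (h y) (h z) d"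
  by (cases d) (simp add: hom_one hom_mult hom_power)

lemma eval_map_poly_hom: "unital_ring_hom (\<lambda>p. poly (map_poly h p) a)"
proof
  have pCons: "poly (map_poly h (pCons c p)) a = h c + a * poly (map_poly h p) a" for c p
    by (simp add: map_poly_pCons hom_zero)
  show add: "poly (map_poly h (p + q)) a = poly (map_poly h p) a + poly (map_poly h q) a" for p q
    by (induction p q rule: poly_induct2) (simp_all add: pCons hom_add algebra_simps)
  have smult: "poly (map_poly h (smult c p)) a = h c * poly (map_poly h p) a" for c p
    by (induction p) (simp_all add: pCons hom_mult algebra_simps)
  show "poly (map_poly h (p * q)) a = poly (map_poly h p) a * poly (map_poly h q) a" for p q
    by (induction p) (simp_all add: pCons add smult hom_zero algebra_simps)
  show "poly (map_poly h 1) a = 1"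
    by (simp add: hom_one)
qed

end

lemma subst4_hom: "unital_ring_hom (\<lambda>P. subst4 P w x y z)"
proof -
  have "unital_ring_hom (of_int :: int \<Rightarrow> 'a)"
    by unfold_locales simp_all
  then show ?thesis
    unfolding subst4_def by (intro unital_ring_hom.eval_map_poly_hom)
qed

lemma subst4_vars:
  "subst4 var_w w x y z = w" "subst4 var_x w x y z = x"
  "subst4 var_y w x y z = y" "subst4 var_z w x y z = z"
  by (simp_all add: subst4_def var_w_def var_x_def var_y_def var_z_def map_poly_pCons)

section \<open>Counting single unmarked powers\<close>

lemma single_unmarked_powers_eq:
  assumes "restricted_colored_partition m P" and "m < 3 ^ N"
  shows "single_unmarked_powers P = (\<lambda>j. 3 ^ j) ` {j. j < N \<and> count P (3 ^ j, Unmarked) = 1}"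
proof -
  have "j < N" if "count P (3 ^ j, Unmarked) = 1" for j
  proof -
    from that have "(3 ^ j, Unmarked) \<in># P" by (metis count_eq_zero_iff zero_neq_one)
    from part_exponent_less[OF assms this] show ?thesis by auto
  qed
  then show ?thesis by (auto simp: single_unmarked_powers_def)
qed

lemma card_single_unmarked_powers:
  assumes "restricted_colored_partition m P" and "m < 3 ^ N"
  shows "card (single_unmarked_powers P) = card {j. j < N \<and> count P (3 ^ j, Unmarked) = 1}"
  unfolding single_unmarked_powers_eq[OF assms] by (intro card_image inj_onI) simp

text \<open>
  With \<open>w = x = z = 1\<close> the weight of a digit is \<open>t\<close> if there is exactly one unmarked copy and
  1 otherwise, so the product of the weights counts the single unmarked powers in the exponent.
\<close>

lemma specialised_S_poly:
  fixes t :: "'a::comm_ring_1"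
  assumes "m < 3 ^ N"
  shows "subst4 (S_poly m) 1 1 t 1 =
    (\<Sum>P | restricted_colored_partition m P. t ^ card (single_unmarked_powers P))"
proof -
  interpret unital_ring_hom "\<lambda>P. subst4 P 1 1 t 1" by (rule subst4_hom)
  have "(\<Prod>j<N. digit_weight 1 1 t 1 (multiplicities P j)) = t ^ card (single_unmarked_powers P)"
    if "restricted_colored_partition m P" for P
  proof -
    have "(\<Prod>j<N. digit_weight 1 1 t 1 (multiplicities P j)) =
        (\<Prod>j<N. if count P (3 ^ j, Unmarked) = 1 then t else 1)"
      by (intro prod.cong) (auto simp: multiplicities_def)
    also have "\<dots> = t ^ card {j. j < N \<and> count P (3 ^ j, Unmarked) = 1}"
      by (simp add: prod.If_cases Collect_conj_eq lessThan_def)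
    finally show ?thesis by (simp add: card_single_unmarked_powers[OF that assms])
  qed
  then show ?thesis
    by (simp add: S_poly_eq_sum_partitions[OF assms] hom_sum hom_prod hom_digit_weight subst4_vars)
qed

lemma coeff_specialised_S_poly:
  "coeff (subst4 (S_poly m) 1 1 [:0, 1:] 1 :: int poly) k = int (num_partitions_single_unmarked m k)"
proof -
  \<comment> \<open>Any number of factors that is large enough will do; \<open>m\<close> factors always are.\<close>
  have "m < 3 ^ m" by (induction m) auto
  then have "coeff (subst4 (S_poly m) 1 1 [:0, 1:] 1 :: int poly) k =
      (\<Sum>P | restricted_colored_partition m P. coeff ([:0, 1:] ^ card (single_unmarked_powers P)) k)"
    by (simp only: specialised_S_poly coeff_sum)
  also have "\<dots> = (\<Sum>P | restricted_colored_partition m P.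
      if card (single_unmarked_powers P) = k then 1 else 0)"
  proof (intro sum.cong refl)
    have "([:0, 1:] :: int poly) ^ c = monom 1 c" for c
      by (simp add: monom_altdef)
    then show "coeff ([:0, 1 :: int:] ^ card (single_unmarked_powers P)) k =
        (if card (single_unmarked_powers P) = k then 1 else 0)" for P
      by simp
  qed
  also have "\<dots> = int (card {P \<in> {P. restricted_colored_partition m P}. card (single_unmarked_powers P) = k})"
    by (simp only: sum.inter_filter[OF finite_restricted_colored_partitions, symmetric] sum_constant of_nat_id mult_1_right)
  finally show ?thesis
    by (simp add: num_partitions_single_unmarked_def)
qed

lemma sum_powers_of_3: "(\<Sum>j<n. 3 ^ j :: nat) = (3 ^ n - 1) div 2"
  by (induction n) auto

lemma card_single_unmarked_powers_le:
  assumes "restricted_colored_partition m P" and "m < 3 ^ n"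
  shows "card (single_unmarked_powers P) \<le> n"
  using card_mono[of "{..<n}" "{j. j < n \<and> count P (3 ^ j, Unmarked) = 1}"]
  by (auto simp: card_single_unmarked_powers[OF assms])

text \<open>
  If all of \<open>1, 3, \<dots>, 3 ^ (n - 1)\<close> occur, the partitioned number is at least their sum
  \<open>(3 ^ n - 1) / 2\<close>.
\<close>

lemma card_single_unmarked_powers_less:
  assumes P: "restricted_colored_partition m P" and m: "m < (3 ^ n - 1) div 2"
  shows "card (single_unmarked_powers P) < n"
proof (rule ccontr)
  assume "\<not> card (single_unmarked_powers P) < n"
  have m': "m < 3 ^ n" using m by auto
  let ?J = "{j. j < n \<and> count P (3 ^ j, Unmarked) = 1}"
  have "card ?J = card {..<n}"
    using \<open>\<not> _\<close> card_single_unmarked_powers_le[OF P m'] card_single_unmarked_powers[OF P m'] by simp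
  then have "?J = {..<n}" by (intro card_subset_eq) auto
  then have "count P (3 ^ j, Unmarked) = 1" if "j < n" for j
    using that by blast
  then have "1 \<le> digit_value (multiplicities P j)" if "j < n" for j
    using that by (simp add: multiplicities_def)
  then have "(\<Sum>j<n. 3 ^ j) \<le> (\<Sum>j<n. 3 ^ j * digit_value (multiplicities P j))"
    by (intro sum_mono) auto
  also have "\<dots> = m" by (rule restricted_colored_partition_value[OF P m'])
  finally show False using m by (simp add: sum_powers_of_3)
qed

lemma poly_eq_sum_monom_if_bounded:
  assumes "\<And>P. restricted_colored_partition m P \<Longrightarrow> card (single_unmarked_powers P) \<le> b"
  defines "p \<equiv> subst4 (S_poly m) 1 1 [:0, 1:] 1 :: int poly"
  shows "p = (\<Sum>k=0..b. monom (coeff p k) k)"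
proof -
  have "coeff p k = 0" if "b < k" for k
  proof -
    from assms(1) that have "{P. restricted_colored_partition m P \<and> card (single_unmarked_powers P) = k} = {}"
      by force
    then show ?thesis
      unfolding p_def coeff_specialised_S_poly num_partitions_single_unmarked_def
      by (simp only: card.empty of_nat_0)
  qed
  then have "degree p \<le> b" by (intro degree_le) auto
  then show ?thesis by (simp add: poly_as_sum_of_monoms' atLeast0AtMost)
qed

theorem proposition4p1:
  fixes n :: nat
  assumes "n \<ge> 1"
  shows
    "Q1_poly n = (\<Sum>k=0..n-1. monom (coeff (Q1_poly n) k) k) \<and>
     R1_poly n = (\<Sum>k=0..n. monom (coeff (R1_poly n) k) k) \<and>
     (\<forall>k\<in>{0..n-1}. coeff (Q1_poly n) k =
        int (num_partitions_single_unmarked ((3 ^ n - 3) div 2) k)) \<and>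
     (\<forall>k\<in>{0..n}. coeff (R1_poly n) k =
        int (num_partitions_single_unmarked ((3 ^ n - 1) div 2) k))"
proof (intro conjI ballI)
  \<comment> \<open>As \<open>3 \<le> 3 ^ n\<close>, the truncated subtractions on natural numbers are exact.\<close>
  have "(3::nat) ^ 1 \<le> 3 ^ n" using assms by (intro power_increasing) auto
  then have less: "(3 ^ n - 3) div 2 < (3 ^ n - 1) div (2::nat)" "(3 ^ n - 1) div 2 < (3::nat) ^ n"
    by auto
  show "Q1_poly n = (\<Sum>k=0..n-1. monom (coeff (Q1_poly n) k) k)"
    unfolding Q1_poly_def Q_poly_def
    using card_single_unmarked_powers_less[OF _ less(1)]
    by (intro poly_eq_sum_monom_if_bounded) force
  show "R1_poly n = (\<Sum>k=0..n. monom (coeff (R1_poly n) k) k)"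
    unfolding R1_poly_def R_poly_def
    using card_single_unmarked_powers_le[OF _ less(2)]
    by (intro poly_eq_sum_monom_if_bounded)
qed (simp_all add: Q1_poly_def Q_poly_def R1_poly_def R_poly_def coeff_specialised_S_poly)

end
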